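(* Let $\alpha\in(1,2)$, $T>0$, $r\ge 1$, $N$ a positive integer, let $A$ be the stiffness matrix and $G=\mathrm{diag}(\delta(x_1),\dots,\delta(x_{2N-1}))$. Let $B:=A(\lambda I+\mu G)$ with $\lambda=1+2^{r(\alpha-1)}T$ and $\mu=(\alpha-1)2^{-r\alpha-1}$, where $I$ is the identity matrix. Then $B=(b_{ij})\in\mathbb{R}^{(2N-1)\times(2N-1)}$ is strictly diagonally dominant (by rows), with positive entries on the main diagonal and negative off-diagonal entries. Moreover, for $1\le i\le 2N-1$, $$\sum_{j=1}^{2N-1}b_{ij}\ge C_A\left(\big(x_i^{-\alpha}+(2T-x_i)^{-\alpha}\big)+(T-\delta(x_i)+h_N)^{1-\alpha}\right),\qquad C_A=\frac{\kappa_\alpha(\alpha-1)}{\Gamma(2-\alpha)}2^{-r\alpha}.$$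
   Context: Graded mesh on $(0,2T)$: $x_j=T(j/N)^r$ for $0\le j\le N$, $x_j=2T-T((2N-j)/N)^r$ for $N+1\le j\le 2N$; $h_j=x_j-x_{j-1}$ for $1\le j\le 2N$. $\delta(x)=\min\{x,2T-x\}$. $\kappa_\alpha=-\frac{1}{2\cos(\alpha\pi/2)}>0$. Stiffness matrix $A=(a_{ij})\in\mathbb{R}^{(2N-1)\times(2N-1)}$: $$a_{ij}=-\frac{2}{h_i+h_{i+1}}\left(\frac1{h_i}\tilde a_{i-1,j}-\Big(\frac1{h_i}+\frac1{h_{i+1}}\Big)\tilde a_{i,j}+\frac1{h_{i+1}}\tilde a_{i+1,j}\right),$$ where for $0\le i\le 2N$, $1\le j\le 2N-1$, $$\tilde a_{ij}=\frac{\kappa_\alpha}{\Gamma(4-\alpha)}\left(\frac{|x_i-x_{j-1}|^{3-\alpha}}{h_j}-\Big(\frac1{h_j}+\frac1{h_{j+1}}\Big)|x_i-x_j|^{3-\alpha}+\frac{|x_i-x_{j+1}|^{3-\alpha}}{h_{j+1}}\right).$$ *)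

theory Defs
  imports "HOL-Analysis.Gamma_Function" "Jordan_Normal_Form.Matrix"
begin

(* T: half-length of the interval (0,2T); r: grading exponent; nodes j = 0,...,2N *)
definition mesh :: "real \<Rightarrow> real \<Rightarrow> nat \<Rightarrow> nat \<Rightarrow> real" where
  "mesh T r N j =
    (if j \<le> N then T * (real j / real N) powr r
     else 2 * T - T * ((2 * real N - real j) / real N) powr r)"

(* only meaningful for 1 \<le> j \<le> 2N *)
definition mesh_size :: "real \<Rightarrow> real \<Rightarrow> nat \<Rightarrow> nat \<Rightarrow> real" where
  "mesh_size T r N j = mesh T r N j - mesh T r N (j - 1)"

definition bdry_dist :: "real \<Rightarrow> real \<Rightarrow> real" where
  "bdry_dist T x = min x (2 * T - x)"

definition kappa :: "real \<Rightarrow> real" where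
  "kappa \<alpha> = - (1 / (2 * cos (\<alpha> * pi / 2)))"

definition atilde :: "real \<Rightarrow> real \<Rightarrow> real \<Rightarrow> nat \<Rightarrow> nat \<Rightarrow> nat \<Rightarrow> real" where
  "atilde \<alpha> T r N i j =
    (let x = mesh T r N; h = mesh_size T r N in
      kappa \<alpha> / Gamma (4 - \<alpha>) *
      (\<bar>x i - x (j - 1)\<bar> powr (3 - \<alpha>) / h j
        - (1 / h j + 1 / h (j + 1)) * \<bar>x i - x j\<bar> powr (3 - \<alpha>)
        + \<bar>x i - x (j + 1)\<bar> powr (3 - \<alpha>) / h (j + 1)))"

(* indices as on paper: 1 \<le> i, j \<le> 2N - 1 *)
definition stiffness_entry :: "real \<Rightarrow> real \<Rightarrow> real \<Rightarrow> nat \<Rightarrow> nat \<Rightarrow> nat \<Rightarrow> real" where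
  "stiffness_entry \<alpha> T r N i j =
    (let h = mesh_size T r N; a = atilde \<alpha> T r N in
      - (2 / (h i + h (i + 1))) *
      (1 / h i * a (i - 1) j
        - (1 / h i + 1 / h (i + 1)) * a i j
        + 1 / h (i + 1) * a (i + 1) j))"

(* Matrices are indexed from 0, so position (i, j) holds the entry a_{i+1,j+1};
   likewise for the diagonal matrix below. *)
definition stiffness_mat :: "real \<Rightarrow> real \<Rightarrow> real \<Rightarrow> nat \<Rightarrow> real mat" where
  "stiffness_mat \<alpha> T r N =
    Matrix.mat (2 * N - 1) (2 * N - 1) (\<lambda>(i, j). stiffness_entry \<alpha> T r N (i + 1) (j + 1))"

definition bdry_dist_mat :: "real \<Rightarrow> real \<Rightarrow> nat \<Rightarrow> real mat" where
  "bdry_dist_mat T r N = mat_diag (2 * N - 1) (\<lambda>i. bdry_dist T (mesh T r N (i + 1)))"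

(* by rows *)
definition strictly_diag_dominant :: "real mat \<Rightarrow> bool" where
  "strictly_diag_dominant M \<longleftrightarrow>
    square_mat M \<and>
    (\<forall>i < dim_row M. (\<Sum>j \<in> {..<dim_col M} - {i}. \<bar>M $$ (i, j)\<bar>) < \<bar>M $$ (i, i)\<bar>)"

end

theory Submission
  imports Defs
begin

text \<open>
  Put \<open>p = 3 - \<alpha>\<close>. Up to a positive factor, \<open>a\<^sub>i\<^sub>j\<close> is minus the second divided difference in \<open>y\<close>
  over the nodes around \<open>x\<^sub>i\<close> and in \<open>z\<close> over those around \<open>x\<^sub>j\<close> of the kernel \<open>\<bar>y - z\<bar> powr p\<close>.
  For \<open>\<bar>i - j\<bar> \<ge> 2\<close> its sign is that of the fourth derivative of the kernel; for neighbours it needs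
  that the interval shared by the two stencils is no longer than one of the intervals next to it,
  which a graded mesh guarantees.

  Summation by parts turns \<open>\<Sum>\<^sub>j a\<^sub>i\<^sub>j\<close> and \<open>\<Sum>\<^sub>j a\<^sub>i\<^sub>j \<delta>(x\<^sub>j)\<close> into second divided differences of explicit
  functions: \<open>g y + g (2T - y)\<close> with \<open>g y = (y\<^sup>p - \<bar>y - x\<^sub>1\<bar>\<^sup>p) / x\<^sub>1\<close>, and \<open>y\<^sup>p + (2T - y)\<^sup>p - 2 \<bar>y - T\<bar>\<^sup>p\<close>.
  Bounding second derivatives, together with \<open>x\<^sub>i\<^sub>+\<^sub>1 \<le> 2\<^sup>r x\<^sub>i\<close>, gives the row sum bound: \<open>\<lambda>\<close> and \<open>\<mu>\<close> are
  such that the bad terms \<open>y\<^sup>p + (2T - y)\<^sup>p\<close> of the second sum are absorbed by the first. Positivity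
  of the diagonal and dominance follow from positive row sums and negative off-diagonal entries.
\<close>

section \<open>Second divided differences\<close>

text \<open>A difference of neighbouring slopes, that is, the second divided difference times
  \<open>c - a\<close>. Without that normalisation it matches \<open>atilde\<close>, which is not
  scaled in \<open>j\<close>; only the outer difference in a stiffness entry is divided by half its
  stencil width.\<close>

definition dd3 :: "(real \<Rightarrow> real) \<Rightarrow> real \<Rightarrow> real \<Rightarrow> real \<Rightarrow> real" where
  "dd3 f a b c = (f c - f b) / (c - b) - (f b - f a) / (b - a)"

lemma dd3_add: "dd3 (\<lambda>x. f x + g x) a b c = dd3 f a b c + dd3 g a b c"
  by (simp add: dd3_def diff_divide_distrib add_divide_distrib)

lemma dd3_cmult: "dd3 (\<lambda>x. k * f x) a b c = k * dd3 f a b c"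
  by (simp add: dd3_def diff_divide_distrib algebra_simps)

lemma dd3_sum: "finite S \<Longrightarrow> dd3 (\<lambda>x. \<Sum>j\<in>S. f j x) a b c = (\<Sum>j\<in>S. dd3 (f j) a b c)"
  by (induction S rule: finite_induct) (simp_all add: dd3_add, simp add: dd3_def)

lemma dd3_reflect: "dd3 (\<lambda>x. f (s - x)) a b c = dd3 f (s - c) (s - b) (s - a)"
  by (simp add: dd3_def diff_divide_distrib algebra_simps)

text \<open>Both sides are the same combination of nine values of \<open>f\<close>. For a symmetric
  kernel the two stencils can thus exchange roles.\<close>

lemma dd3_swap:
  "dd3 (\<lambda>x. dd3 (\<lambda>y. f x y) a' b' c') a b c = dd3 (\<lambda>y. dd3 (\<lambda>x. f x y) a b c) a' b' c'"
  by (simp add: dd3_def diff_divide_distrib add_divide_distrib ac_simps)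

lemma dd3_cong: "f a = g a \<Longrightarrow> f b = g b \<Longrightarrow> f c = g c \<Longrightarrow> dd3 f a b c = dd3 g a b c"
  by (simp add: dd3_def)

text \<open>The mean value theorem on each half turns the slopes into \<open>f' u\<close> and
  \<open>f' v\<close>; a third application, to \<open>f'\<close>, compares these. The factor
  \<open>d = v - u\<close> stays unspecified, since only its sign matters later. Derivatives are
  required in the open interval only, because a power with exponent in (1, 2) has no second
  derivative where its base vanishes.\<close>

lemma dd3_mean_value:
  assumes ab: "a < b" and bc: "b < c" and cont: "continuous_on {a..c} f"
    and f': "\<And>x. a < x \<Longrightarrow> x < c \<Longrightarrow> (f has_real_derivative f' x) (at x)"
    and f'': "\<And>x. a < x \<Longrightarrow> x < c \<Longrightarrow> (f' has_real_derivative f'' x) (at x)"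
  obtains d x where "0 < d" "a < x" "x < c" "dd3 f a b c = d * f'' x"
proof -
  have diff: "f differentiable at x" if "a < x" "x < c" for x
    using f'[OF that] real_differentiable_def by blast
  have "\<exists>l z. a < z \<and> z < b \<and> DERIV f z :> l \<and> f b - f a = (b - a) * l"
    using ab bc diff by (intro MVT continuous_on_subset[OF cont]) auto
  then obtain u where u: "a < u" "u < b" "f b - f a = (b - a) * f' u"
    using bc f' by (smt (verit) DERIV_unique)
  have "\<exists>l z. b < z \<and> z < c \<and> DERIV f z :> l \<and> f c - f b = (c - b) * l"
    using ab bc diff by (intro MVT continuous_on_subset[OF cont]) auto
  then obtain v where v: "b < v" "v < c" "f c - f b = (c - b) * f' v"
    using ab f' by (smt (verit) DERIV_unique)
  obtain x where x: "u < x" "x < v" "f' v - f' u = (v - u) * f'' x"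
    using MVT2[of u v f' f''] u v f'' by auto
  have "dd3 f a b c = f' v - f' u"
    using u v ab bc by (simp add: dd3_def)
  with x u v show ?thesis
    by (intro that[of "v - u" x]) auto
qed

lemma dd3_pos:
  assumes "a < b" "b < c" "continuous_on {a..c} f"
    and "\<And>x. a < x \<Longrightarrow> x < c \<Longrightarrow> (f has_real_derivative f' x) (at x)"
    and "\<And>x. a < x \<Longrightarrow> x < c \<Longrightarrow> (f' has_real_derivative f'' x) (at x)"
    and "\<And>x. a < x \<Longrightarrow> x < c \<Longrightarrow> 0 < f'' x"
  shows "0 < dd3 f a b c"
proof -
  obtain d x where "0 < d" "a < x" "x < c" "dd3 f a b c = d * f'' x"
    by (rule dd3_mean_value[OF assms(1-5)])
  then show ?thesis
    using assms(6) by simp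
qed

text \<open>Subtracting the parabola \<open>m / 2 * x\<^sup>2\<close>, whose difference is known
  exactly, leaves a function with second derivative \<open>f'' - m\<close>, which is
  nonnegative.\<close>

lemma dd3_ge:
  assumes ab: "a < b" and bc: "b < c" and cont: "continuous_on {a..c} f"
    and f': "\<And>x. a < x \<Longrightarrow> x < c \<Longrightarrow> (f has_real_derivative f' x) (at x)"
    and f'': "\<And>x. a < x \<Longrightarrow> x < c \<Longrightarrow> (f' has_real_derivative f'' x) (at x)"
    and m: "\<And>x. a < x \<Longrightarrow> x < c \<Longrightarrow> m \<le> f'' x"
  shows "m * ((c - a) / 2) \<le> dd3 f a b c"
proof -
  have "\<exists>d x. 0 < d \<and> a < x \<and> x < c \<and>
      dd3 (\<lambda>x. f x + (- m / 2) * x\<^sup>2) a b c = d * (f'' x - m)"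
    by (rule dd3_mean_value[OF ab bc, of "\<lambda>x. f x + (- m / 2) * x\<^sup>2" "\<lambda>x. f' x - m * x" "\<lambda>x. f'' x - m"])
      (use cont f' f'' in \<open>auto intro!: continuous_intros derivative_eq_intros\<close>)
  then have "0 \<le> dd3 (\<lambda>x. f x + (- m / 2) * x\<^sup>2) a b c"
    using m by fastforce
  also have "\<dots> = dd3 f a b c + (- m / 2) * dd3 (\<lambda>x. x\<^sup>2) a b c"
    by (simp only: dd3_add dd3_cmult)
  also have "dd3 (\<lambda>x. x\<^sup>2) a b c = c - a"
    using ab bc by (simp add: dd3_def power2_eq_square square_diff_square_factored)
  finally show ?thesis
    by simp
qed

lemma dd3_has_real_derivative:
  assumes "\<And>y. y \<in> {a, b, c} \<Longrightarrow> ((\<lambda>x. F x y) has_real_derivative F' y) (at x)"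
  shows "((\<lambda>x. dd3 (F x) a b c) has_real_derivative dd3 F' a b c) (at x)"
proof -
  have "((\<lambda>x. F x a) has_real_derivative F' a) (at x)" "((\<lambda>x. F x b) has_real_derivative F' b) (at x)"
    "((\<lambda>x. F x c) has_real_derivative F' c) (at x)"
    using assms by auto
  then show ?thesis
    unfolding dd3_def by (intro DERIV_diff DERIV_cdivide)
qed

lemma has_real_derivative_powr_comp:
  assumes "(g has_real_derivative m) (at x)" "0 < g x" "D = r * g x powr (r - 1) * m"
  shows "((\<lambda>x. g x powr r) has_real_derivative D) (at x)"
  using DERIV_fun_powr[OF assms(1,2), of r] assms(3) by simp

section \<open>Sign of the mixed divided difference of the kernel\<close>

text \<open>Two derivatives in \<open>x\<close>, taken under the inner difference, leave
  \<open>p * (p - 1)\<close> times a difference in \<open>y\<close> of the power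
  \<open>p - 2\<close>, which is convex. Touching stencils, \<open>x2 = y0\<close>, are covered
  because derivatives are taken only for \<open>x < x2\<close>.\<close>

lemma dd3_dd3_powr_far:
  assumes p: "1 < p" "p < 2" and x: "x0 < x1" "x1 < x2" and "x2 \<le> y0" and y: "y0 < y1" "y1 < y2"
  shows "0 < dd3 (\<lambda>x. dd3 (\<lambda>y. \<bar>x - y\<bar> powr p) y0 y1 y2) x0 x1 x2"
proof -
  have "0 < dd3 (\<lambda>x. dd3 (\<lambda>y. (y - x) powr p) y0 y1 y2) x0 x1 x2"
  proof (rule dd3_pos[OF x])
    show "continuous_on {x0..x2} (\<lambda>x. dd3 (\<lambda>y. (y - x) powr p) y0 y1 y2)"
      unfolding dd3_def using assms by (intro continuous_intros continuous_on_powr') auto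
  next
    fix x assume x: "x0 < x" "x < x2"
    show "((\<lambda>x. dd3 (\<lambda>y. (y - x) powr p) y0 y1 y2) has_real_derivative
        dd3 (\<lambda>y. - (p * (y - x) powr (p - 1))) y0 y1 y2) (at x)"
      using assms x
      by (intro dd3_has_real_derivative has_real_derivative_powr_comp[where m = "-1"])
        (auto intro!: derivative_eq_intros)
    show "((\<lambda>x. dd3 (\<lambda>y. - (p * (y - x) powr (p - 1))) y0 y1 y2) has_real_derivative
        dd3 (\<lambda>y. p * (p - 1) * (y - x) powr (p - 2)) y0 y1 y2) (at x)"
      using assms x
      by (intro dd3_has_real_derivative DERIV_minus)
        (auto intro!: derivative_eq_intros has_real_derivative_powr_comp[where m = "-1"])
    have "0 < dd3 (\<lambda>y. (y - x) powr (p - 2)) y0 y1 y2"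
    proof (rule dd3_pos[OF y])
      show "continuous_on {y0..y2} (\<lambda>y. (y - x) powr (p - 2))"
        using assms x by (intro continuous_intros) auto
    next
      fix y assume "y0 < y" "y < y2"
      then have y: "x < y" using x assms by simp
      show "((\<lambda>y. (y - x) powr (p - 2)) has_real_derivative (p - 2) * (y - x) powr (p - 3)) (at y)"
        using y by (intro has_real_derivative_powr_comp[where m = 1]) (auto intro!: derivative_eq_intros)
      show "((\<lambda>y. (p - 2) * (y - x) powr (p - 3)) has_real_derivative (p - 2) * ((p - 3) * (y - x) powr (p - 4))) (at y)"
        using y by (intro DERIV_cmult has_real_derivative_powr_comp[where m = 1]) (auto intro!: derivative_eq_intros)
      show "0 < (p - 2) * ((p - 3) * (y - x) powr (p - 4))"
        using y p by (intro mult_neg_neg mult_neg_pos) auto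
    qed
    then show "0 < dd3 (\<lambda>y. p * (p - 1) * (y - x) powr (p - 2)) y0 y1 y2"
      using p by (subst dd3_cmult) auto
  qed
  also have "\<dots> = dd3 (\<lambda>x. dd3 (\<lambda>y. \<bar>x - y\<bar> powr p) y0 y1 y2) x0 x1 x2"
    using assms by (intro dd3_cong) (auto simp: abs_if intro!: dd3_cong)
  finally show ?thesis .
qed

text \<open>The trapezoidal rule overestimates the integral of the convex function
  \<open>(p - 1) * u powr (p - 2)\<close> from \<open>s\<close> to \<open>s + t\<close>.\<close>

lemma powr_diff_le_trapezoid:
  fixes p s t :: real
  assumes p: "1 < p" "p < 2" and s: "0 < s" "0 \<le> t"
  shows "(s + t) powr (p - 1) - s powr (p - 1) \<le> (p - 1) * (s powr (p - 2) + (s + t) powr (p - 2)) * t / 2"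
proof -
  define g where "g u = (p - 1) * (s powr (p - 2) + (s + u) powr (p - 2)) * u / 2 - (s + u) powr (p - 1)" for u
  have "g 0 \<le> g t"
  proof (rule DERIV_nonneg_imp_nondecreasing[OF \<open>0 \<le> t\<close>])
    fix u assume u: "0 \<le> u" "u \<le> t"
    \<comment> \<open>The convex power \<open>p - 2\<close> lies above its tangent at
      \<open>s + u\<close>; this is read off at the point \<open>s\<close>.\<close>
    have tangent: "(2 - p) * u * (s + u) powr (p - 3) \<le> s powr (p - 2) - (s + u) powr (p - 2)"
    proof (cases "u = 0")
      case False
      have "\<exists>z>s. z < s + u \<and> (s + u) powr (p - 2) - s powr (p - 2) = (s + u - s) * ((p - 2) * z powr (p - 3))"
        using False u s
        by (intro MVT2 has_real_derivative_powr_comp[where m = 1]) (auto intro!: derivative_eq_intros)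
      then obtain z where z: "s < z" "z < s + u"
        "(s + u) powr (p - 2) - s powr (p - 2) = u * ((p - 2) * z powr (p - 3))"
        by auto
      have "(s + u) powr (p - 3) \<le> z powr (p - 3)"
        using z s p by (intro powr_mono2') auto
      then have "(2 - p) * u * (s + u) powr (p - 3) \<le> (2 - p) * u * z powr (p - 3)"
        using p u by (intro mult_left_mono) auto
      then show ?thesis
        using z(3) by (simp add: algebra_simps)
    qed simp
    have "(g has_real_derivative ((p - 1) / 2 * (s powr (p - 2) - (s + u) powr (p - 2)
       - (2 - p) * u * (s + u) powr (p - 3)))) (at u)"
      unfolding g_def using s u
      by (auto intro!: derivative_eq_intros has_real_derivative_powr_comp[where m = 1] simp: field_simps)
    then show "\<exists>y. (g has_real_derivative y) (at u) \<and> 0 \<le> y"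
      using tangent p by (intro exI conjI) (assumption, auto)
  qed
  then show ?thesis
    by (simp add: g_def)
qed

text \<open>
  Here \<open>s\<close> is the length of the neighbouring interval divided by that of the shared one. Without
  \<open>1 \<le> s\<close> this fails: the expression vanishes at \<open>s = 0\<close> and is negative for small \<open>s > 0\<close>.
\<close>

lemma powr_adjacent_kernel_nonneg:
  fixes p s :: real
  assumes p: "1 < p" "p < 2" and s: "1 \<le> s"
  shows "0 \<le> p * (1 + s) powr (p - 1) - (1 + s) powr p + s powr p - (p - 1) + (2 - p) * s"
proof -
  define E where "E s = p * (1 + s) powr (p - 1) - (1 + s) powr p + s powr p - (p - 1) + (2 - p) * s" for s
  have "2 powr (p - 1) \<le> (2::real) powr 1"
    using p by (intro powr_mono) auto
  \<comment> \<open>The value at \<open>s = 1\<close> factors into nonnegative terms, and from there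
    on \<open>E\<close> does not decrease.\<close>
  then have "0 \<le> (2 - p) * (2 - 2 powr (p - 1))"
    using p by simp
  also have "\<dots> = E 1"
    by (simp add: E_def powr_diff field_simps)
  also have "E 1 \<le> E s"
  proof (rule DERIV_nonneg_imp_nondecreasing[OF s])
    fix s' :: real assume s: "1 \<le> s'"
    let ?E' = "p * ((p - 1) * (1 + s') powr (p - 2)) - p * (1 + s') powr (p - 1) + p * s' powr (p - 1) + (2 - p)"
    have "\<exists>z>s'. z < s' + 1 \<and> (s' + 1) powr (p - 2) - s' powr (p - 2) = (s' + 1 - s') * ((p - 2) * z powr (p - 3))"
      using s by (intro MVT2 has_real_derivative_powr_comp[where m = 1]) (auto intro!: derivative_eq_intros)
    then obtain z where z: "s' < z" "(s' + 1) powr (p - 2) - s' powr (p - 2) = (p - 2) * z powr (p - 3)"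
      by auto
    have "z powr (p - 3) \<le> 1 powr (p - 3)"
      using z s p by (intro powr_mono2') auto
    then have "(2 - p) * z powr (p - 3) \<le> (2 - p) * 1"
      using p by (intro mult_left_mono) auto
    then have 1: "s' powr (p - 2) - (1 + s') powr (p - 2) \<le> 2 - p"
      using z(2) by (simp add: algebra_simps)
    \<comment> \<open>Once the difference of powers \<open>p - 1\<close> in \<open>?E'\<close> is
      replaced by its trapezoid bound, this is the term that the summand \<open>2 - p\<close> has to
      absorb.\<close>
    have 2: "p * (p - 1) / 2 * (s' powr (p - 2) - (1 + s') powr (p - 2)) \<le> 1 * (2 - p)"
    proof (rule mult_mono[OF _ 1])
      \<comment> \<open>The product is \<open>p * (p - 1) - 2\<close>.\<close>
      have "(p - 2) * (p + 1) \<le> 0" using p by (intro mult_nonpos_nonneg) auto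
      then show "p * (p - 1) / 2 \<le> 1" by (simp add: algebra_simps)
    next
      have "(1 + s') powr (p - 2) \<le> s' powr (p - 2)"
        using s p by (intro powr_mono2') auto
      then show "0 \<le> s' powr (p - 2) - (1 + s') powr (p - 2)" by simp
    qed simp
    have "p * ((1 + s') powr (p - 1) - s' powr (p - 1)) \<le> p * ((p - 1) * (s' powr (p - 2) + (1 + s') powr (p - 2)) / 2)"
      using powr_diff_le_trapezoid[OF p, of s' 1] s p by (intro mult_left_mono) (auto simp: add.commute)
    with 2 have "0 \<le> ?E'"
      by (simp add: field_simps)
    moreover have "(E has_real_derivative ?E') (at s')"
      unfolding E_def using s
      by (auto intro!: derivative_eq_intros has_real_derivative_powr_comp[where m = 1])
    ultimately show "\<exists>y. (E has_real_derivative y) (at s') \<and> 0 \<le> y"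
      by blast
  qed
  finally show ?thesis
    by (simp add: E_def)
qed

lemma dd3_powr_pos:
  assumes k: "0 < k * (k - 1)" and x: "x0 < x1" "x1 < x2" "x2 < y"
  shows "0 < dd3 (\<lambda>x. (y - x) powr k) x0 x1 x2"
proof (rule dd3_pos[OF x(1,2)])
  show "continuous_on {x0..x2} (\<lambda>x. (y - x) powr k)"
    using x by (intro continuous_intros) auto
next
  fix x assume "x0 < x" "x < x2"
  then have y: "x < y" using assms by simp
  show "((\<lambda>x. (y - x) powr k) has_real_derivative - (k * (y - x) powr (k - 1))) (at x)"
    using y by (intro has_real_derivative_powr_comp[where m = "-1"]) (auto intro!: derivative_eq_intros)
  show "((\<lambda>x. - (k * (y - x) powr (k - 1))) has_real_derivative k * (k - 1) * (y - x) powr (k - 2)) (at x)"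
    using y by (auto intro!: derivative_eq_intros has_real_derivative_powr_comp[where m = "-1"])
  show "0 < k * (k - 1) * (y - x) powr (k - 2)"
    using y k by simp
qed

text \<open>The kernel is not smooth on the shared interval, so the two slopes of \<open>v\<close>
  are compared through \<open>v' x2\<close>. The slope right of \<open>x2\<close> is larger because
  \<open>v'\<close> increases there; the slope between \<open>x1\<close> and \<open>x2\<close> is at
  most \<open>v' x2\<close>, which after scaling is
  \<open>powr_adjacent_kernel_nonneg\<close>.\<close>

lemma dd3_dd3_powr_adjacent:
  assumes p: "1 < p" "p < 2" and x: "x0 < x1" "x1 < x2" "x2 < x3" and le: "x2 - x1 \<le> x1 - x0"
  shows "0 < dd3 (\<lambda>x. dd3 (\<lambda>y. \<bar>x - y\<bar> powr p) x1 x2 x3) x0 x1 x2"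
proof -
  define v where "v y = dd3 (\<lambda>x. \<bar>x - y\<bar> powr p) x0 x1 x2" for y
  define v' where "v' y = dd3 (\<lambda>x. p * (y - x) powr (p - 1)) x0 x1 x2" for y
  have v: "v y = dd3 (\<lambda>x. (y - x) powr p) x0 x1 x2" if "x2 \<le> y" for y
    unfolding v_def using that x by (intro dd3_cong) (auto simp: abs_if)
  have cont: "continuous_on {x2..x3} (\<lambda>y. dd3 (\<lambda>x. (y - x) powr p) x0 x1 x2)"
    unfolding dd3_def using p x by (intro continuous_intros continuous_on_powr') auto
  obtain z where z: "x2 < z" "v x3 - v x2 = v' z * (x3 - x2)"
  proof (rule mvt[OF x(3) cont])
    fix y assume y: "x2 < y" "y < x3"
    have "((\<lambda>y. dd3 (\<lambda>x. (y - x) powr p) x0 x1 x2) has_real_derivative v' y) (at y)"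
      unfolding v'_def using x y
      by (intro dd3_has_real_derivative has_real_derivative_powr_comp[where m = 1]) (auto intro!: derivative_eq_intros)
    then show "((\<lambda>y. dd3 (\<lambda>x. (y - x) powr p) x0 x1 x2) has_derivative (\<lambda>h. v' y * h)) (at y)"
      by (simp add: has_field_derivative_def)
  qed (use v x in auto)
  have "v' x2 < v' z"
  proof (rule DERIV_pos_imp_increasing_open[OF z(1)])
    show "continuous_on {x2..z} v'"
      unfolding v'_def dd3_def using p x by (intro continuous_intros continuous_on_powr') auto
  next
    fix y assume y: "x2 < y" "y < z"
    have "0 < dd3 (\<lambda>x. p * (p - 1) * (y - x) powr (p - 2)) x0 x1 x2"
      unfolding dd3_cmult using p x y by (intro mult_pos_pos dd3_powr_pos mult_neg_neg) auto
    moreover have "(v' has_real_derivative dd3 (\<lambda>x. p * (p - 1) * (y - x) powr (p - 2)) x0 x1 x2) (at y)"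
      unfolding v'_def using p x y
      by (intro dd3_has_real_derivative) (auto intro!: derivative_eq_intros has_real_derivative_powr_comp[where m = 1])
    ultimately show "\<exists>l. (v' has_real_derivative l) (at y) \<and> 0 < l"
      by blast
  qed
  moreover have "(v x2 - v x1) / (x2 - x1) \<le> v' x2"
  proof -
    \<comment> \<open>By homogeneity only the ratio \<open>s\<close> matters. The scale is
      \<open>b\<close>, and \<open>\<beta>\<close> takes up its non-integer power so that
      \<open>b\<close> enters rationally.\<close>
    define b where "b = x2 - x1"
    define s where "s = (x1 - x0) / b"
    define \<beta> where "\<beta> = b powr (p - 2)"
    have b: "0 < b" and s: "1 \<le> s"
      using x le by (auto simp: b_def s_def)
    have a: "x1 - x0 = s * b" "x2 - x0 = (1 + s) * b"
      using b by (auto simp: s_def b_def field_simps)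
    have "b powr (p - 2 + 1) = b * b powr (p - 2)" "b powr (p - 2 + 2) = b\<^sup>2 * b powr (p - 2)"
      using b by (simp_all only: powr_add) (simp_all)
    then have \<beta>: "b powr (p - 1) = b * \<beta>" "b powr p = b\<^sup>2 * \<beta>"
      by (simp_all add: \<beta>_def)
    have vx2: "v x2 = - b * \<beta> - (b\<^sup>2 * \<beta> - (1 + s) powr p * (b\<^sup>2 * \<beta>)) / (s * b)"
      using b s by (simp add: v dd3_def a powr_mult \<beta> power2_eq_square flip: b_def)
    have vx1: "v x1 = b * \<beta> + s powr p * (b\<^sup>2 * \<beta>) / (s * b)"
    proof -
      have "\<bar>x0 - x1\<bar> = s * b" "\<bar>x2 - x1\<bar> = b" using x a by (auto simp: b_def)
      then show ?thesis
        using b s by (simp add: v_def dd3_def a powr_mult \<beta> power2_eq_square flip: b_def)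
    qed
    have v'x2: "v' x2 = p * (- \<beta> - (b * \<beta> - (1 + s) powr (p - 1) * (b * \<beta>)) / (s * b))"
      using b s by (simp only: v'_def dd3_cmult) (simp add: dd3_def a powr_mult \<beta> power2_eq_square flip: b_def)
    have "v' x2 - (v x2 - v x1) / b =
        \<beta> / s * (p * (1 + s) powr (p - 1) - (1 + s) powr p + s powr p - (p - 1) + (2 - p) * s)"
      unfolding vx2 vx1 v'x2 using b s by (simp add: field_simps power2_eq_square)
    also have "0 \<le> \<dots>"
      using powr_adjacent_kernel_nonneg[OF p s] s by (intro mult_nonneg_nonneg) (auto simp: \<beta>_def)
    finally show ?thesis
      by (simp add: b_def)
  qed
  ultimately have "0 < dd3 v x1 x2 x3"
    using x z by (simp add: dd3_def)
  then show ?thesis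
    by (subst dd3_swap) (simp add: v_def[abs_def])
qed

section \<open>Bounds for the differences of the explicit functions\<close>

text \<open>The function is a difference quotient of the power \<open>p\<close> with step
  \<open>s\<close>, so its second derivative is a third derivative of that power,
  \<open>p * (p - 1) * (p - 2) * z powr (p - 3)\<close>, at some \<open>z < c\<close>. By
  \<open>s \<le> a\<close> the kink at \<open>s\<close> is not inside the stencil.\<close>

lemma dd3_boundary_layer_le:
  assumes p: "1 < p" "p < 2" and "0 < s" "s \<le> a" and abc: "a < b" "b < c"
  shows "dd3 (\<lambda>x. (x powr p - \<bar>x - s\<bar> powr p) / s) a b c \<le> - (p * (p - 1) * (2 - p) * c powr (p - 3)) * ((c - a) / 2)"
proof -
  have "p * (p - 1) * (2 - p) * c powr (p - 3) * ((c - a) / 2) \<le> dd3 (\<lambda>x. ((x - s) powr p - x powr p) / s) a b c"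
  proof (rule dd3_ge[OF abc])
    show "continuous_on {a..c} (\<lambda>x. ((x - s) powr p - x powr p) / s)"
      using assms by (intro continuous_intros continuous_on_powr') auto
  next
    fix x assume x: "a < x" "x < c"
    show "((\<lambda>x. ((x - s) powr p - x powr p) / s) has_real_derivative
        p * ((x - s) powr (p - 1) - x powr (p - 1)) / s) (at x)"
      using assms x
      by (intro DERIV_cdivide) (auto intro!: derivative_eq_intros has_real_derivative_powr_comp[where m = 1] simp: algebra_simps)
    show "((\<lambda>x. p * ((x - s) powr (p - 1) - x powr (p - 1)) / s) has_real_derivative
        p * (p - 1) * ((x - s) powr (p - 2) - x powr (p - 2)) / s) (at x)"
      using assms x
      by (intro DERIV_cdivide) (auto intro!: derivative_eq_intros has_real_derivative_powr_comp[where m = 1] simp: algebra_simps)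
    have "\<exists>z>x - s. z < x \<and> x powr (p - 2) - (x - s) powr (p - 2) = (x - (x - s)) * ((p - 2) * z powr (p - 3))"
      using assms x by (intro MVT2 has_real_derivative_powr_comp[where m = 1]) (auto intro!: derivative_eq_intros)
    then obtain z where z: "x - s < z" "z < x" "x powr (p - 2) - (x - s) powr (p - 2) = s * ((p - 2) * z powr (p - 3))"
      by auto
    have "c powr (p - 3) \<le> z powr (p - 3)"
      using assms x z by (intro powr_mono2') auto
    then have "(2 - p) * c powr (p - 3) \<le> (2 - p) * z powr (p - 3)"
      using p by (intro mult_left_mono) auto
    also have "\<dots> = ((x - s) powr (p - 2) - x powr (p - 2)) / s"
      using z(3) \<open>0 < s\<close> by (simp add: field_simps)
    finally have "p * (p - 1) * ((2 - p) * c powr (p - 3)) \<le> p * (p - 1) * (((x - s) powr (p - 2) - x powr (p - 2)) / s)"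
      using p by (intro mult_left_mono) auto
    then show "p * (p - 1) * (2 - p) * c powr (p - 3) \<le> p * (p - 1) * ((x - s) powr (p - 2) - x powr (p - 2)) / s"
      by (simp add: mult.assoc)
  qed
  also have "\<dots> = dd3 (\<lambda>x. (- 1) * ((x powr p - \<bar>x - s\<bar> powr p) / s)) a b c"
    using assms by (intro dd3_cong) (auto simp: field_simps)
  finally show ?thesis
    unfolding dd3_cmult by simp
qed

text \<open>Now the kink is the middle node, so second derivatives do not help. The difference is
  evaluated explicitly and brought to the form that \<open>dd3_boundary_layer_le\<close> has for
  \<open>a = 0\<close>.\<close>

lemma dd3_boundary_layer_first_le:
  assumes p: "1 < p" "p < 2" and bc: "0 < b" "b < c"
  shows "dd3 (\<lambda>x. (x powr p - \<bar>x - b\<bar> powr p) / b) 0 b c \<le> - (p * (p - 1) * (2 - p) * c powr (p - 3)) * (c / 2)"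
proof -
  have cont: "continuous_on {b..c} (\<lambda>x. x powr p - (x - b) powr p)"
    using assms by (intro continuous_intros continuous_on_powr') auto
  obtain z where z: "b < z" "z < c"
    "(c powr p - (c - b) powr p) - (b powr p - (b - b) powr p) =
      (p * z powr (p - 1) - p * (z - b) powr (p - 1)) * (c - b)"
  proof (rule mvt[OF bc(2) cont])
    fix x assume x: "b < x" "x < c"
    have "((\<lambda>x. x powr p - (x - b) powr p) has_real_derivative
         (p * x powr (p - 1) - p * (x - b) powr (p - 1))) (at x)"
      using assms x by (auto intro!: derivative_eq_intros has_real_derivative_powr_comp[where m = 1])
    then show "((\<lambda>x. x powr p - (x - b) powr p) has_derivative
         (\<lambda>h. (p * x powr (p - 1) - p * (x - b) powr (p - 1)) * h)) (at x)"
      by (simp add: has_field_derivative_def)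
  qed blast
  have eq: "x powr (p - 1) = x * x powr (p - 2)" if "0 < x" for x :: real
    using that powr_add[of x 1 "p - 2"] by simp
  have eq': "x powr p = x * x powr (p - 1)" if "0 < x" for x :: real
    using that powr_add[of x 1 "p - 1"] by simp
  \<comment> \<open>Subadditivity of the power \<open>p - 1\<close>, whose exponent is below
    1.\<close>
  have "z powr (p - 1) = (z - b) * z powr (p - 2) + b * z powr (p - 2)"
    using z bc by (subst eq) (auto simp: algebra_simps)
  also have "\<dots> \<le> (z - b) * (z - b) powr (p - 2) + b * b powr (p - 2)"
    using z bc p by (intro add_mono mult_left_mono powr_mono2') auto
  also have "\<dots> = (z - b) powr (p - 1) + b * b powr (p - 2)"
    using z eq[of "z - b"] by simp
  finally have "p * (z powr (p - 1) - (z - b) powr (p - 1)) * (c - b) \<le> p * (b * b powr (p - 2)) * (c - b)"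
    using p bc by (intro mult_right_mono mult_left_mono) auto
  then have *: "c powr p - (c - b) powr p - b powr p \<le> p * (b * b powr (p - 2)) * (c - b)"
    using z(3) p by (simp add: algebra_simps)
  have "dd3 (\<lambda>x. (x powr p - \<bar>x - b\<bar> powr p) / b) 0 b c =
      (c powr p - (c - b) powr p - b powr p) / (b * (c - b)) - 2 * b powr (p - 2)"
    using bc p by (simp add: dd3_def eq' eq) (simp add: field_simps)
  also have "\<dots> \<le> p * b powr (p - 2) - 2 * b powr (p - 2)"
    using * bc by (simp add: field_simps)
  also have "\<dots> = - ((2 - p) * b powr (p - 2))"
    by (simp add: algebra_simps)
  also have "\<dots> \<le> - ((2 - p) * (p * (p - 1) / 2 * c powr (p - 2)))"
  proof -
    have "(p - 2) * (p + 1) \<le> 0" using p by (intro mult_nonpos_nonneg) auto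
    then have "p * (p - 1) / 2 \<le> 1" by (simp add: algebra_simps)
    then have "p * (p - 1) / 2 * c powr (p - 2) \<le> 1 * b powr (p - 2)"
      using p bc by (intro mult_mono powr_mono2') auto
    then show ?thesis
      using p by (simp add: mult_left_mono)
  qed
  also have "\<dots> = - (p * (p - 1) * (2 - p) * c powr (p - 3)) * (c / 2)"
    using powr_add[of c 1 "p - 3"] bc by (simp add: field_simps)
  finally show ?thesis .
qed

lemma dd3_powr_le:
  assumes p: "1 < p" "p < 2" and abc: "0 < a" "a < b" "b < c"
  shows "dd3 (\<lambda>x. x powr p) a b c \<le> p * (p - 1) * a powr (p - 2) * ((c - a) / 2)"
proof -
  have "- (p * (p - 1) * a powr (p - 2)) * ((c - a) / 2) \<le> dd3 (\<lambda>x. (- 1) * x powr p) a b c"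
  proof (rule dd3_ge[OF abc(2,3)])
    show "continuous_on {a..c} (\<lambda>x. (- 1) * x powr p)"
      using assms by (intro continuous_intros) auto
  next
    fix x assume x: "a < x" "x < c"
    show "((\<lambda>x. (- 1) * x powr p) has_real_derivative - (p * x powr (p - 1))) (at x)"
      using abc x by (auto intro!: derivative_eq_intros has_real_derivative_powr_comp[where m = 1])
    show "((\<lambda>x. - (p * x powr (p - 1))) has_real_derivative - (p * (p - 1) * x powr (p - 2))) (at x)"
      using abc x by (auto intro!: derivative_eq_intros has_real_derivative_powr_comp[where m = 1])
    show "- (p * (p - 1) * a powr (p - 2)) \<le> - (p * (p - 1) * x powr (p - 2))"
      using abc x p by (auto intro!: mult_left_mono powr_mono2')
  qed
  then show ?thesis
    unfolding dd3_cmult by simp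
qed

text \<open>Since \<open>0 powr (p - 2)\<close> is 0, the bound of \<open>dd3_powr_le\<close> would
  be false at \<open>a = 0\<close>. Instead the difference equals \<open>c\<close> times a slope of
  the power \<open>p - 1\<close>. The bound is twice what the second derivative at \<open>b\<close>
  would suggest.\<close>

lemma dd3_powr_first_le:
  assumes p: "1 < p" "p < 2" and bc: "0 < b" "b < c"
  shows "dd3 (\<lambda>x. x powr p) 0 b c \<le> p * (p - 1) * b powr (p - 2) * c"
proof -
  have eq: "x powr p = x * x powr (p - 1)" if "0 < x" for x :: real
    using that powr_add[of x 1 "p - 1"] by simp
  have "\<exists>z>b. z < c \<and> c powr (p - 1) - b powr (p - 1) = (c - b) * ((p - 1) * z powr (p - 2))"
    using bc by (intro MVT2 has_real_derivative_powr_comp[where m = 1]) (auto intro!: derivative_eq_intros)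
  then obtain z where z: "b < z" "c powr (p - 1) - b powr (p - 1) = (c - b) * ((p - 1) * z powr (p - 2))"
    by auto
  have "dd3 (\<lambda>x. x powr p) 0 b c = c * ((c powr (p - 1) - b powr (p - 1)) / (c - b))"
    using bc p by (simp add: dd3_def eq) (simp add: field_simps)
  also have "\<dots> = c * (1 * (p - 1) * z powr (p - 2))"
    using z bc by simp
  also have "\<dots> \<le> c * (p * (p - 1) * b powr (p - 2))"
    using z bc p by (intro mult_left_mono mult_mono powr_mono2') auto
  finally show ?thesis
    by (simp add: mult_ac)
qed

lemma dd3_powr_abs_ge:
  assumes p: "1 < p" "p < 2" and abc: "a < b" "b < c" "c \<le> t"
  shows "p * (p - 1) * (t - a) powr (p - 2) * ((c - a) / 2) \<le> dd3 (\<lambda>x. \<bar>x - t\<bar> powr p) a b c"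
proof -
  have "p * (p - 1) * (t - a) powr (p - 2) * ((c - a) / 2) \<le> dd3 (\<lambda>x. (t - x) powr p) a b c"
  proof (rule dd3_ge[OF abc(1,2)])
    show "continuous_on {a..c} (\<lambda>x. (t - x) powr p)"
      using assms by (intro continuous_intros continuous_on_powr') auto
  next
    fix x assume x: "a < x" "x < c"
    show "((\<lambda>x. (t - x) powr p) has_real_derivative - (p * (t - x) powr (p - 1))) (at x)"
      using abc x by (auto intro!: derivative_eq_intros has_real_derivative_powr_comp[where m = "-1"])
    show "((\<lambda>x. - (p * (t - x) powr (p - 1))) has_real_derivative p * (p - 1) * (t - x) powr (p - 2)) (at x)"
      using abc x by (auto intro!: derivative_eq_intros has_real_derivative_powr_comp[where m = "-1"])
    show "p * (p - 1) * (t - a) powr (p - 2) \<le> p * (p - 1) * (t - x) powr (p - 2)"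
      using abc x p by (auto intro!: mult_left_mono powr_mono2')
  qed
  also have "\<dots> = dd3 (\<lambda>x. \<bar>x - t\<bar> powr p) a b c"
    using abc by (intro dd3_cong) (auto simp: abs_if)
  finally show ?thesis .
qed

text \<open>The stencil symmetric about the kink gives exactly \<open>2 * h powr p / h\<close>, and
  \<open>p * (p - 1) \<le> 2\<close>.\<close>

lemma dd3_powr_abs_center_ge:
  assumes p: "1 < p" "p < 2" and h: "0 < h"
  shows "p * (p - 1) * h powr (p - 2) * h \<le> dd3 (\<lambda>x. \<bar>x - t\<bar> powr p) (t - h) t (t + h)"
proof -
  have "(p - 2) * (p + 1) \<le> 0" using p by (intro mult_nonpos_nonneg) auto
  then have "p * (p - 1) * (h powr (p - 2) * h) \<le> 2 * (h powr (p - 2) * h)"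
    using h by (intro mult_right_mono) (auto simp: algebra_simps)
  also have "\<dots> = 2 * h powr p / h"
    using powr_add[of h 2 "p - 2"] h by (simp add: field_simps power2_eq_square)
  also have "\<dots> = dd3 (\<lambda>x. \<bar>x - t\<bar> powr p) (t - h) t (t + h)"
    using h p by (simp add: dd3_def)
  finally show ?thesis
    by (simp add: mult.assoc)
qed

section \<open>Summation by parts and reflection\<close>

text \<open>Abel summation: \<open>dd3\<close> is an increment of slopes, and slopes times the
  increments of an affine weight telescope to \<open>v\<close> times an increment of
  \<open>f\<close>. Constants and both halves of \<open>bdry_dist\<close> are such weights.\<close>

lemma sum_affine_dd3:
  fixes z :: "nat \<Rightarrow> real"
  assumes "m \<le> M" and "\<And>j. j < M \<Longrightarrow> z j \<noteq> z (Suc j)"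
  shows "(\<Sum>j = Suc m..M. (u + v * z j) * dd3 f (z (j - 1)) (z j) (z (j + 1))) =
    (u + v * z M) * ((f (z (Suc M)) - f (z M)) / (z (Suc M) - z M))
    - (u + v * z m) * ((f (z (Suc m)) - f (z m)) / (z (Suc m) - z m)) - v * (f (z M) - f (z m))"
  using assms
proof (induction M rule: dec_induct)
  case (step M)
  define s where "s j = (f (z (Suc j)) - f (z j)) / (z (Suc j) - z j)" for j
  have "f (z (Suc M)) - f (z M) = (z (Suc M) - z M) * s M"
    using step.prems[of M] by (simp add: s_def)
  then have *: "f (z (Suc M)) - f (z m) = (z (Suc M) - z M) * s M + (f (z M) - f (z m))"
    by simp
  have IH: "(\<Sum>j = Suc m..M. (u + v * z j) * dd3 f (z (j - 1)) (z j) (z (j + 1))) =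
      (u + v * z M) * s M - (u + v * z m) * s m - v * (f (z M) - f (z m))"
    using step.IH step.prems by (simp add: s_def)
  have "dd3 f (z M) (z (Suc M)) (z (Suc (Suc M))) = s (Suc M) - s M"
    by (simp add: dd3_def s_def)
  then have "(\<Sum>j = Suc m..Suc M. (u + v * z j) * dd3 f (z (j - 1)) (z j) (z (j + 1))) =
      (u + v * z M) * s M - (u + v * z m) * s m - v * (f (z M) - f (z m))
      + (u + v * z (Suc M)) * (s (Suc M) - s M)"
    using step.hyps by (simp only: IH sum.cl_ivl_Suc) simp
  then show ?case
    unfolding * s_def[symmetric] by (simp add: algebra_simps)
qed simp

text \<open>Provides the mirror image of \<open>dd3_dd3_powr_adjacent\<close>, with the long
  neighbour on the other side.\<close>

lemma dd3_dd3_abs_uminus: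
  "dd3 (\<lambda>y. dd3 (\<lambda>z. \<bar>y - z\<bar> powr p) (- c') (- b') (- a')) (- c) (- b) (- a) =
    dd3 (\<lambda>y. dd3 (\<lambda>z. \<bar>y - z\<bar> powr p) a' b' c') a b c"
proof -
  have inner: "dd3 (\<lambda>z. \<bar>y - z\<bar> powr p) (- c') (- b') (- a') = dd3 (\<lambda>z. \<bar>- y - z\<bar> powr p) a' b' c'" for y
    using dd3_reflect[of "\<lambda>z. \<bar>y - z\<bar> powr p" 0 a' b' c'] by (simp add: abs_minus_commute[of "- y"] add.commute)
  show ?thesis
    using dd3_reflect[of "\<lambda>y. dd3 (\<lambda>z. \<bar>- y - z\<bar> powr p) a' b' c'" 0 a b c] by (simp add: inner)
qed

section \<open>The graded mesh\<close>

locale graded_mesh =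
  fixes T r :: real and N :: nat
  assumes T: "0 < T" and r: "1 \<le> r" and N: "1 \<le> N"
begin

abbreviation (input) "x \<equiv> mesh T r N"
abbreviation (input) "h \<equiv> mesh_size T r N"

lemma mesh_0: "x 0 = 0" and mesh_N: "x N = T"
  using N r by (simp_all add: mesh_def)

lemma mesh_reflect: "j \<le> 2 * N \<Longrightarrow> x (2 * N - j) = 2 * T - x j"
  using N by (cases j N rule: linorder_cases) (auto simp: mesh_def of_nat_diff)

lemma mesh_less_Suc: "j < 2 * N \<Longrightarrow> x j < x (Suc j)"
proof -
  have *: "x j < x (Suc j)" if "j < N" for j
    using that T r N by (auto simp: mesh_def intro!: powr_less_mono2 divide_strict_right_mono)
  assume j: "j < 2 * N"
  show ?thesis
  proof (cases "j < N")
    case False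
    have "x (2 * N - Suc j) < x (Suc (2 * N - Suc j))"
      using False j by (intro *) auto
    then show ?thesis
      using j mesh_reflect[of "Suc j"] mesh_reflect[of j] by (simp add: Suc_diff_Suc)
  qed (rule *)
qed

lemma mesh_less: "i < j \<Longrightarrow> j \<le> 2 * N \<Longrightarrow> x i < x j"
proof (induction j)
  case (Suc j)
  then show ?case
    using mesh_less_Suc[of j] by (cases "i = j") auto
qed simp

lemma mesh_le: "i \<le> j \<Longrightarrow> j \<le> 2 * N \<Longrightarrow> x i \<le> x j"
  using mesh_less[of i j] by (cases "i = j") auto

lemma mesh_2N: "x (2 * N) = 2 * T"
  using mesh_reflect[of 0] mesh_0 by simp

text \<open>In the left half this is \<open>i + 1 \<le> 2 * i\<close>; from the midpoint on, both
  nodes lie between \<open>T\<close> and \<open>2 * T\<close>, and \<open>1 \<le> r\<close>.\<close>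

lemma mesh_Suc_le:
  assumes "1 \<le> i" "i < 2 * N"
  shows "x (Suc i) \<le> 2 powr r * x i"
proof (cases "i < N")
  case True
  have "((1 + real i) / real N) powr r \<le> (2 * (real i / real N)) powr r"
    using assms N r by (intro powr_mono2) (auto simp: field_simps)
  also have "\<dots> = 2 powr r * (real i / real N) powr r"
    by (rule powr_mult; simp)
  finally show ?thesis
    using True T by (simp add: mesh_def algebra_simps)
next
  case False
  have "x (Suc i) \<le> 2 powr 1 * T"
    using mesh_le[of "Suc i" "2 * N"] assms mesh_2N by simp
  also have "\<dots> \<le> 2 powr r * x i"
    using r T mesh_le[of N i] mesh_N assms False by (intro mult_mono powr_mono) auto
  finally show ?thesis .
qed

lemma mesh_size_reflect:
  assumes "j < 2 * N"
  shows "h (2 * N - j) = h (Suc j)"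
  using assms mesh_reflect[of j] mesh_reflect[of "Suc j"] by (simp add: mesh_size_def)

text \<open>The nodes sample a function that is convex by \<open>1 \<le> r\<close>, and on
  consecutive integers \<open>dd3\<close> is the increment of the mesh sizes.\<close>

lemma mesh_size_mono_Suc:
  assumes "1 \<le> j" "j < N"
  shows "h j \<le> h (Suc j)"
proof -
  have "0 * ((real (Suc j) - real (j - 1)) / 2) \<le> dd3 (\<lambda>t. T * (t / real N) powr r) (real (j - 1)) (real j) (real (Suc j))"
  proof (rule dd3_ge)
    show "continuous_on {real (j - 1)..real (Suc j)} (\<lambda>t. T * (t / real N) powr r)"
    proof -
      have "0 \<le> t" if "real (j - 1) \<le> t" for t :: real
        using that of_nat_0_le_iff order_trans by blast
      then show ?thesis
        using r N by (intro continuous_intros continuous_on_powr' ballI) auto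
    qed
  next
    fix t assume "real (j - 1) < t"
    then have t: "0 < t" by (smt (verit) of_nat_0_le_iff)
    show "((\<lambda>t. T * (t / real N) powr r) has_real_derivative
        T * (r * (t / real N) powr (r - 1) * (1 / real N))) (at t)"
      using t N by (intro DERIV_cmult has_real_derivative_powr_comp[where m = "1 / real N"])
        (auto intro!: derivative_eq_intros)
    show "((\<lambda>t. T * (r * (t / real N) powr (r - 1) * (1 / real N))) has_real_derivative
        T * (r * ((r - 1) * (t / real N) powr (r - 2) * (1 / real N)) * (1 / real N))) (at t)"
      using t N by (intro DERIV_cmult DERIV_cmult_right has_real_derivative_powr_comp[where m = "1 / real N"])
        (auto intro!: derivative_eq_intros)
    show "0 \<le> T * (r * ((r - 1) * (t / real N) powr (r - 2) * (1 / real N)) * (1 / real N))"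
      using T r by simp
  qed (use assms in auto)
  also have "\<dots> = h (Suc j) - h j"
  proof -
    have "j - 1 \<le> N" "Suc j \<le> N"
      using assms by auto
    then show ?thesis
      using assms by (simp add: dd3_def mesh_size_def mesh_def of_nat_diff)
  qed
  finally show ?thesis
    by simp
qed

lemma mesh_size_le_N:
  assumes "1 \<le> j" "j \<le> N"
  shows "h j \<le> h N"
  using assms(2)
proof (induction j rule: inc_induct)
  case (step n)
  with mesh_size_mono_Suc[of n] assms(1) show ?case by simp
qed simp

lemma mesh_triple:
  assumes "1 \<le> i" "i \<le> 2 * N - 1"
  shows "x (i - 1) < x i" "x i < x (i + 1)"
  using assms mesh_less[of "i - 1" i] mesh_less[of i "i + 1"] N by auto

text \<open>Transfers estimates near 0 to the endpoint \<open>2 * T\<close>.\<close>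

lemma dd3_mesh_reflect:
  assumes "1 \<le> i" "i \<le> 2 * N - 1"
  shows "dd3 (\<lambda>y. f (2 * T - y)) (x (i - 1)) (x i) (x (i + 1)) =
    dd3 f (x (2 * N - i - 1)) (x (2 * N - i)) (x (2 * N - i + 1))"
proof -
  have *: "2 * N - i - 1 = 2 * N - (i + 1)" "2 * N - i + 1 = 2 * N - (i - 1)"
    using assms by auto
  show ?thesis
    unfolding dd3_reflect * using assms by (subst (1 2 3) mesh_reflect) auto
qed

lemma width_mesh_reflect:
  assumes "1 \<le> i" "i \<le> 2 * N - 1"
  shows "x (2 * N - i + 1) - x (2 * N - i - 1) = x (i + 1) - x (i - 1)"
proof -
  have *: "2 * N - i - 1 = 2 * N - (i + 1)" "2 * N - i + 1 = 2 * N - (i - 1)"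
    using assms by auto
  show ?thesis
    unfolding * using assms by (subst (1 2) mesh_reflect) auto
qed

section \<open>Estimates on mesh stencils\<close>

lemma dd3_dd3_mesh_pos_less:
  assumes p: "1 < p" "p < 2" and ij: "1 \<le> i" "i < j" "j \<le> 2 * N - 1"
  shows "0 < dd3 (\<lambda>y. dd3 (\<lambda>z. \<bar>y - z\<bar> powr p) (x (j - 1)) (x j) (x (j + 1))) (x (i - 1)) (x i) (x (i + 1))"
proof (cases "j = i + 1")
  case False
  then show ?thesis
    using p ij mesh_triple[of i] mesh_triple[of j] mesh_le[of "i + 1" "j - 1"]
    by (intro dd3_dd3_powr_far) auto
next
  case j: True
  have x: "x (i - 1) < x i" "x i < x (i + 1)" "x (i + 1) < x (i + 2)"
    using ij j mesh_triple[of i] mesh_triple[of j] by auto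
  show ?thesis
  proof (cases "i < N")
    \<comment> \<open>From the midpoint on, mesh sizes do not increase, so the left neighbour of the
      shared interval is long enough.\<close>
    case False
    then have "h (i + 1) \<le> h i"
      using mesh_size_mono_Suc[of "2 * N - i"] mesh_size_reflect[of i] mesh_size_reflect[of "i - 1"] ij j
      by (cases "i = N") (auto simp: Suc_diff_le)
    then have "x (i + 1) - x i \<le> x i - x (i - 1)"
      by (simp add: mesh_size_def)
    with dd3_dd3_powr_adjacent[OF p x] show ?thesis
      by (simp add: j)
  next
    \<comment> \<open>In the left half the long neighbour is on the right; a reflection and an
      exchange of the stencils reduce this to the same lemma.\<close>
    case True
    then have "h (i + 1) \<le> h (i + 2)"
      using mesh_size_mono_Suc[of "i + 1"] mesh_size_reflect[of "N - 1"] ij j mesh_size_reflect[of N]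
      by (cases "i + 1 = N") auto
    then have le: "- x i - (- x (i + 1)) \<le> - x (i + 1) - (- x (i + 2))"
      by (simp add: mesh_size_def)
    have "0 < dd3 (\<lambda>y. dd3 (\<lambda>z. \<bar>y - z\<bar> powr p) (- x (i + 1)) (- x i) (- x (i - 1))) (- x (i + 2)) (- x (i + 1)) (- x i)"
      using x by (intro dd3_dd3_powr_adjacent[OF p _ _ _ le]) auto
    also have "\<dots> = dd3 (\<lambda>y. dd3 (\<lambda>z. \<bar>y - z\<bar> powr p) (x (i - 1)) (x i) (x (i + 1))) (x i) (x (i + 1)) (x (i + 2))"
      by (rule dd3_dd3_abs_uminus)
    also have "\<dots> = dd3 (\<lambda>z. dd3 (\<lambda>y. \<bar>z - y\<bar> powr p) (x i) (x (i + 1)) (x (i + 2))) (x (i - 1)) (x i) (x (i + 1))"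
      by (subst dd3_swap) (simp add: abs_minus_commute)
    finally show ?thesis
      by (simp add: j)
  qed
qed

lemma dd3_dd3_mesh_pos:
  assumes p: "1 < p" "p < 2" and ij: "1 \<le> i" "i \<le> 2 * N - 1" "1 \<le> j" "j \<le> 2 * N - 1" "i \<noteq> j"
  shows "0 < dd3 (\<lambda>y. dd3 (\<lambda>z. \<bar>y - z\<bar> powr p) (x (j - 1)) (x j) (x (j + 1))) (x (i - 1)) (x i) (x (i + 1))"
proof (cases "i < j")
  case True
  then show ?thesis
    using dd3_dd3_mesh_pos_less[OF p] ij by auto
next
  case False
  then show ?thesis
    using dd3_dd3_mesh_pos_less[OF p, of j i] ij by (subst dd3_swap) (auto simp: abs_minus_commute)
qed

text \<open>Passing from \<open>x (i + 1)\<close> to \<open>x i\<close> with the negative exponent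
  \<open>p - 3\<close> costs the factor \<open>2 powr (r * (p - 3))\<close>, which later enters the
  constant of the row sum bound.\<close>

lemma dd3_mesh_boundary_layer_le:
  assumes p: "1 < p" "p < 2" and i: "1 \<le> i" "i \<le> 2 * N - 1"
  shows "dd3 (\<lambda>y. (y powr p - \<bar>y - x 1\<bar> powr p) / x 1) (x (i - 1)) (x i) (x (i + 1))
    \<le> - (p * (p - 1) * (2 - p) * 2 powr (r * (p - 3)) * x i powr (p - 3)) * ((x (i + 1) - x (i - 1)) / 2)"
proof -
  have pos: "0 < x 1" "0 < x i"
    using mesh_less[of 0 1] mesh_less[of 0 i] i N mesh_0 by auto
  have "dd3 (\<lambda>y. (y powr p - \<bar>y - x 1\<bar> powr p) / x 1) (x (i - 1)) (x i) (x (i + 1))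
      \<le> - (p * (p - 1) * (2 - p) * x (i + 1) powr (p - 3)) * ((x (i + 1) - x (i - 1)) / 2)"
  \<comment> \<open>Only the first stencil has the kink \<open>x 1\<close> as its middle
    node.\<close>
  proof (cases "i = 1")
    case True
    then show ?thesis
      using dd3_boundary_layer_first_le[OF p, of "x 1" "x 2"] mesh_triple[OF i] mesh_0 by (simp add: numeral_2_eq_2)
  next
    case False
    then show ?thesis
      using mesh_triple[OF i] pos mesh_le[of 1 "i - 1"] i
      by (intro dd3_boundary_layer_le[OF p]) auto
  qed
  also have "\<dots> \<le> - (p * (p - 1) * (2 - p) * (2 powr (r * (p - 3)) * x i powr (p - 3))) * ((x (i + 1) - x (i - 1)) / 2)"
  proof -
    have "2 powr (r * (p - 3)) * x i powr (p - 3) = (2 powr r * x i) powr (p - 3)"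
      by (simp add: powr_mult powr_powr)
    also have "\<dots> \<le> x (i + 1) powr (p - 3)"
      using mesh_triple[OF i] pos mesh_Suc_le[of i] i p N by (intro powr_mono2') auto
    finally show ?thesis
      using mesh_triple[OF i] p by (intro mult_right_mono) (auto intro!: mult_left_mono)
  qed
  finally show ?thesis
    by (simp add: mult.assoc)
qed

text \<open>The natural bound has the power \<open>p - 2\<close>. One factor \<open>x i\<close> is
  traded for \<open>2 * T\<close> to make it comparable with the boundary layer term, which has the
  power \<open>p - 3\<close>.\<close>

lemma dd3_mesh_powr_le:
  assumes p: "1 < p" "p < 2" and i: "1 \<le> i" "i \<le> 2 * N - 1"
  shows "dd3 (\<lambda>y. y powr p) (x (i - 1)) (x i) (x (i + 1))
    \<le> p * (p - 1) * (2 powr (r * (2 - p)) * (2 * T) * x i powr (p - 3)) * ((x (i + 1) - x (i - 1)) / 2)"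
proof -
  have pos: "0 < x i"
    using mesh_less[of 0 i] i N mesh_0 by auto
  have eq: "x i powr (p - 2) = x i * x i powr (p - 3)"
    using powr_add[of "x i" 1 "p - 3"] pos by simp
  show ?thesis
  proof (cases "i = 1")
    case True
    have "2 powr 0 \<le> (2 :: real) powr (r * (2 - p))"
      using p r by (intro powr_mono) auto
    \<comment> \<open>The bound \<open>T\<close> in place of \<open>2 * T\<close> makes up for the
      factor 2 lost in \<open>dd3_powr_first_le\<close>.\<close>
    moreover have "x 1 \<le> T"
      using mesh_le[of 1 N] N mesh_N by simp
    ultimately have "1 * x 1 * x 1 powr (p - 3) \<le> 2 powr (r * (2 - p)) * T * x 1 powr (p - 3)"
      using pos True by (intro mult_right_mono mult_mono) auto
    then have "p * (p - 1) * x 1 powr (p - 2) * x 2 \<le> p * (p - 1) * (2 powr (r * (2 - p)) * T * x 1 powr (p - 3)) * x 2"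
      using mesh_triple[OF i] p True pos eq by (intro mult_right_mono mult_left_mono) (auto simp: numeral_2_eq_2)
    moreover have "dd3 (\<lambda>y. y powr p) 0 (x 1) (x 2) \<le> p * (p - 1) * x 1 powr (p - 2) * x 2"
      using mesh_triple[OF i] True pos by (intro dd3_powr_first_le[OF p]) (auto simp: numeral_2_eq_2)
    ultimately show ?thesis
      using True mesh_0 by (simp add: numeral_2_eq_2 mult_ac)
  next
    case False
    have a: "0 < x (i - 1)"
      using mesh_less[of 0 "i - 1"] i False mesh_0 by auto
    have "x i \<le> 2 powr r * x (i - 1)"
      using mesh_Suc_le[of "i - 1"] i False by auto
    then have "2 powr - r * x i \<le> x (i - 1)"
      by (simp add: powr_minus field_simps)
    then have "x (i - 1) powr (p - 2) \<le> (2 powr - r * x i) powr (p - 2)"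
      using pos p by (intro powr_mono2') auto
    also have "\<dots> = 2 powr (r * (2 - p)) * (x i powr (p - 2))"
      by (simp add: powr_mult powr_powr algebra_simps)
    also have "\<dots> \<le> 2 powr (r * (2 - p)) * (2 * T * x i powr (p - 3))"
      unfolding eq using mesh_le[of i "2 * N"] mesh_2N i by (intro mult_left_mono mult_right_mono) auto
    finally have *: "x (i - 1) powr (p - 2) \<le> 2 powr (r * (2 - p)) * (2 * T) * x i powr (p - 3)"
      by (simp add: mult.assoc)
    have "dd3 (\<lambda>y. y powr p) (x (i - 1)) (x i) (x (i + 1))
      \<le> p * (p - 1) * x (i - 1) powr (p - 2) * ((x (i + 1) - x (i - 1)) / 2)"
      using mesh_triple[OF i] a by (intro dd3_powr_le[OF p]) auto
    also have "\<dots> \<le> p * (p - 1) * (2 powr (r * (2 - p)) * (2 * T) * x i powr (p - 3)) * ((x (i + 1) - x (i - 1)) / 2)"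
      using * p mesh_triple[OF i] by (intro mult_right_mono mult_left_mono) auto
    finally show ?thesis .
  qed
qed

text \<open>The summand \<open>h N\<close> comes from the left stencil node:
  \<open>T - x (i - 1) = T - x i + h i\<close> and \<open>h i \<le> h N\<close>. At
  \<open>i = N\<close> the stencil is symmetric about \<open>T\<close>.\<close>

lemma dd3_mesh_powr_abs_ge_left:
  assumes p: "1 < p" "p < 2" and i: "1 \<le> i" "i \<le> N"
  shows "p * (p - 1) * (T - x i + h N) powr (p - 2) * ((x (i + 1) - x (i - 1)) / 2)
    \<le> dd3 (\<lambda>y. \<bar>y - T\<bar> powr p) (x (i - 1)) (x i) (x (i + 1))"
proof (cases "i = N")
  case True
  have "h (Suc N) = h N"
    using mesh_size_reflect[of N] N by simp
  then have "x (N - 1) = T - h N" "x (Suc N) = T + h N"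
    using mesh_N by (auto simp: mesh_size_def)
  moreover have "0 < h N"
    using mesh_triple[of N] N by (auto simp: mesh_size_def)
  ultimately show ?thesis
    using dd3_powr_abs_center_ge[OF p, of "h N" T] True mesh_N by simp
next
  case False
  have i': "i \<le> 2 * N - 1" using i by auto
  have le: "x (i + 1) \<le> T"
    using mesh_le[of "i + 1" N] mesh_N i False by simp
  have "h i \<le> h N"
    using i by (intro mesh_size_le_N)
  then have "(T - x i + h N) powr (p - 2) \<le> (T - x (i - 1)) powr (p - 2)"
    using p mesh_triple[OF i(1) i'] le by (intro powr_mono2') (auto simp: mesh_size_def)
  then have "p * (p - 1) * (T - x i + h N) powr (p - 2) * ((x (i + 1) - x (i - 1)) / 2)
      \<le> p * (p - 1) * (T - x (i - 1)) powr (p - 2) * ((x (i + 1) - x (i - 1)) / 2)"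
    using p mesh_triple[OF i(1) i'] by (intro mult_right_mono mult_left_mono) auto
  also have "\<dots> \<le> dd3 (\<lambda>y. \<bar>y - T\<bar> powr p) (x (i - 1)) (x i) (x (i + 1))"
    using mesh_triple[OF i(1) i'] le by (intro dd3_powr_abs_ge[OF p])
  finally show ?thesis .
qed

lemma bdry_dist_mesh:
  "i \<le> N \<Longrightarrow> bdry_dist T (x i) = x i"
  "N \<le> i \<Longrightarrow> i \<le> 2 * N \<Longrightarrow> bdry_dist T (x i) = 2 * T - x i"
  using mesh_le[of i N] mesh_le[of N i] mesh_N by (auto simp: bdry_dist_def)

lemma dd3_mesh_powr_abs_ge:
  assumes p: "1 < p" "p < 2" and i: "1 \<le> i" "i \<le> 2 * N - 1"
  shows "p * (p - 1) * (T - bdry_dist T (x i) + h N) powr (p - 2) * ((x (i + 1) - x (i - 1)) / 2)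
    \<le> dd3 (\<lambda>y. \<bar>y - T\<bar> powr p) (x (i - 1)) (x i) (x (i + 1))"
proof (cases "i \<le> N")
  case True
  then show ?thesis
    using dd3_mesh_powr_abs_ge_left[OF p i(1)] bdry_dist_mesh(1) by simp
next
  case False
  have i': "1 \<le> 2 * N - i" "2 * N - i \<le> N"
    using False i by auto
  have "dd3 (\<lambda>y. \<bar>y - T\<bar> powr p) (x (i - 1)) (x i) (x (i + 1)) =
      dd3 (\<lambda>y. \<bar>2 * T - y - T\<bar> powr p) (x (i - 1)) (x i) (x (i + 1))"
    by (simp add: dd3_def abs_minus_commute)
  also have "\<dots> = dd3 (\<lambda>y. \<bar>y - T\<bar> powr p) (x (2 * N - i - 1)) (x (2 * N - i)) (x (2 * N - i + 1))"
    by (rule dd3_mesh_reflect[OF i])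
  finally have eq: "dd3 (\<lambda>y. \<bar>y - T\<bar> powr p) (x (i - 1)) (x i) (x (i + 1)) =
      dd3 (\<lambda>y. \<bar>y - T\<bar> powr p) (x (2 * N - i - 1)) (x (2 * N - i)) (x (2 * N - i + 1))" .
  have "i \<le> 2 * N"
    using i by arith
  then have "bdry_dist T (x i) = x (2 * N - i)"
    using False bdry_dist_mesh(2)[of i] mesh_reflect[of i] by simp
  with eq show ?thesis
    using dd3_mesh_powr_abs_ge_left[OF p i'] by (simp only: width_mesh_reflect[OF i])
qed

section \<open>Summation over the columns\<close>

text \<open>With constant weights only the first and the last slope survive. For the kernel centred
  at \<open>y\<close> they are the boundary layer function at \<open>y\<close> and at
  \<open>2 * T - y\<close>.\<close>

lemma sum_dd3_mesh:
  "(\<Sum>j = 1..2 * N - 1. dd3 f (x (j - 1)) (x j) (x (j + 1))) =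
    (f (2 * T) - f (2 * T - x 1)) / x 1 - (f (x 1) - f 0) / x 1"
proof -
  have "x j \<noteq> x (Suc j)" if "j < 2 * N - 1" for j
    by (rule less_imp_neq, rule mesh_less_Suc) (use that in arith)
  from sum_affine_dd3[of 0 "2 * N - 1" x 1 0 f, OF _ this]
  show ?thesis
    using N mesh_0 mesh_2N mesh_reflect[of 1] by simp
qed

text \<open>The weight is a hat that vanishes at 0 and \<open>2 * T\<close> and bends at the node
  \<open>T\<close>. It is affine on each half, and the slope terms at \<open>T\<close>
  cancel.\<close>

lemma sum_bdry_dist_dd3_mesh:
  "(\<Sum>j = 1..2 * N - 1. bdry_dist T (x j) * dd3 f (x (j - 1)) (x j) (x (j + 1))) =
    f 0 + f (2 * T) - 2 * f T"
proof -
  let ?D = "\<lambda>j. dd3 f (x (j - 1)) (x j) (x (j + 1))"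
  have neq: "x j \<noteq> x (Suc j)" if "j < 2 * N" for j
    using mesh_less_Suc[of j] that by auto
  have "(\<Sum>j = 1..2 * N - 1. bdry_dist T (x j) * ?D j) =
      (\<Sum>j = 1..N. bdry_dist T (x j) * ?D j) + (\<Sum>j = Suc N..2 * N - 1. bdry_dist T (x j) * ?D j)"
    using N by (subst sum.union_disjoint[symmetric]) (auto intro!: sum.cong)
  also have "(\<Sum>j = 1..N. bdry_dist T (x j) * ?D j) = (\<Sum>j = Suc 0..N. (0 + 1 * x j) * ?D j)"
    by (intro sum.cong) (auto simp: bdry_dist_mesh)
  also have "\<dots> = T * ((f (x (Suc N)) - f T) / (x (Suc N) - T)) - (f T - f 0)"
    using neq by (subst sum_affine_dd3) (auto simp: mesh_0 mesh_N)
  also have "(\<Sum>j = Suc N..2 * N - 1. bdry_dist T (x j) * ?D j) =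
      (\<Sum>j = Suc N..2 * N - 1. (2 * T + (- 1) * x j) * ?D j)"
    by (intro sum.cong) (auto simp: bdry_dist_mesh)
  \<comment> \<open>The sum ends at node \<open>2 * N - 1\<close>, where the weight is
    \<open>x 1\<close>; times the last slope this is the increment missing up to
    \<open>2 * T\<close>.\<close>
  also have "\<dots> = x 1 * ((f (2 * T) - f (2 * T - x 1)) / x 1)
      - T * ((f (x (Suc N)) - f T) / (x (Suc N) - T)) + (f (2 * T - x 1) - f T)"
    using neq N by (subst sum_affine_dd3) (auto simp: mesh_2N mesh_N mesh_reflect[of 1, simplified])
  finally show ?thesis
    using mesh_less[of 0 1] mesh_0 N by simp
qed

end

section \<open>The stiffness matrix and its weighted row sums\<close>

lemma kappa_pos: "1 < \<alpha> \<Longrightarrow> \<alpha> < 2 \<Longrightarrow> 0 < kappa \<alpha>"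
proof -
  assume \<alpha>: "1 < \<alpha>" "\<alpha> < 2"
  have "1 * pi < \<alpha> * pi" "\<alpha> * pi < 2 * pi"
    using \<alpha> pi_gt_zero by (auto intro: mult_strict_right_mono)
  then have "0 < sin (\<alpha> * pi / 2 - pi / 2)"
    using pi_gt_zero by (intro sin_gt_zero; linarith)
  then have "cos (\<alpha> * pi / 2) < 0"
    by (simp add: sin_diff)
  then show ?thesis
    by (simp add: kappa_def field_simps zero_less_divide_iff)
qed

lemma atilde_eq_dd3:
  "atilde \<alpha> T r N i j = kappa \<alpha> / Gamma (4 - \<alpha>) *
    dd3 (\<lambda>z. \<bar>mesh T r N i - z\<bar> powr (3 - \<alpha>)) (mesh T r N (j - 1)) (mesh T r N j) (mesh T r N (j + 1))"
  by (simp add: atilde_def Let_def dd3_def mesh_size_def diff_divide_distrib algebra_simps)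

lemma stiffness_entry_eq_dd3:
  "stiffness_entry \<alpha> T r N i j =
    - (2 / (mesh T r N (i + 1) - mesh T r N (i - 1)) * (kappa \<alpha> / Gamma (4 - \<alpha>)) *
      dd3 (\<lambda>y. dd3 (\<lambda>z. \<bar>y - z\<bar> powr (3 - \<alpha>)) (mesh T r N (j - 1)) (mesh T r N j) (mesh T r N (j + 1)))
        (mesh T r N (i - 1)) (mesh T r N i) (mesh T r N (i + 1)))"
proof -
  define K where "K = kappa \<alpha> / Gamma (4 - \<alpha>)"
  define u where "u y = dd3 (\<lambda>z. \<bar>y - z\<bar> powr (3 - \<alpha>)) (mesh T r N (j - 1)) (mesh T r N j) (mesh T r N (j + 1))" for y
  have "mesh_size T r N i + mesh_size T r N (i + 1) = mesh T r N (i + 1) - mesh T r N (i - 1)"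
    by (simp add: mesh_size_def)
  then show ?thesis
    unfolding stiffness_entry_def Let_def atilde_eq_dd3 K_def[symmetric] u_def[symmetric]
    by (simp add: dd3_def[of u] mesh_size_def diff_divide_distrib algebra_simps)
qed

lemma Gamma_4_minus:
  fixes \<alpha> :: real
  assumes "\<alpha> < 2"
  shows "Gamma (4 - \<alpha>) = (3 - \<alpha>) * (2 - \<alpha>) * Gamma (2 - \<alpha>)"
proof -
  have "3 - \<alpha> \<notin> \<int>\<^sub>\<le>\<^sub>0" "2 - \<alpha> \<notin> \<int>\<^sub>\<le>\<^sub>0"
    using assms by (auto dest: nonpos_Ints_nonpos)
  then show ?thesis
    using Gamma_plus1[of "3 - \<alpha>"] Gamma_plus1[of "2 - \<alpha>"] by simp
qed

locale graded_mesh_stiffness = graded_mesh +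
  fixes \<alpha> :: real
  assumes \<alpha>: "1 < \<alpha>" "\<alpha> < 2"
begin

lemma stiffness_entry_neg:
  assumes "1 \<le> i" "i \<le> 2 * N - 1" "1 \<le> j" "j \<le> 2 * N - 1" "i \<noteq> j"
  shows "stiffness_entry \<alpha> T r N i j < 0"
proof -
  have "x (i - 1) < x (i + 1)"
    using mesh_triple[OF assms(1,2)] by simp
  then show ?thesis
    unfolding stiffness_entry_eq_dd3 using dd3_dd3_mesh_pos[OF _ _ assms, of "3 - \<alpha>"] kappa_pos[OF \<alpha>] \<alpha>
    by (simp add: Gamma_real_pos)
qed

lemma row_sum_ge:
  assumes i: "1 \<le> i" "i \<le> 2 * N - 1"
    and lam: "lam = 1 + 2 powr (r * (\<alpha> - 1)) * T"
    and mu: "mu = (\<alpha> - 1) * 2 powr (- r * \<alpha> - 1)"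
  shows "kappa \<alpha> * (\<alpha> - 1) / Gamma (2 - \<alpha>) * 2 powr (- r * \<alpha>) *
      ((x i powr (- \<alpha>) + (2 * T - x i) powr (- \<alpha>)) + (T - bdry_dist T (x i) + h N) powr (1 - \<alpha>))
    \<le> (\<Sum>j = 1..2 * N - 1. stiffness_entry \<alpha> T r N i j * (lam + mu * bdry_dist T (x j)))"
proof -
  define p where "p = 3 - \<alpha>"
  have p: "1 < p" "p < 2" using \<alpha> by (auto simp: p_def)
  define K where "K = kappa \<alpha> / Gamma (4 - \<alpha>)"
  have K: "0 < K"
    using kappa_pos[OF \<alpha>] \<alpha> by (simp add: K_def Gamma_real_pos)
  \<comment> \<open>Half the stencil width, so that \<open>K / D\<close> is the prefactor of a
    stiffness entry.\<close>
  define D where "D = (x (i + 1) - x (i - 1)) / 2"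
  have D: "0 < D"
    using mesh_triple[OF i] by (simp add: D_def)
  define L where "L f = dd3 f (x (i - 1)) (x i) (x (i + 1))" for f
  define g where "g y = (y powr p - \<bar>y - x 1\<bar> powr p) / x 1" for y
  define Q where "Q = p * (p - 1) * (2 - p) * 2 powr (r * (p - 3))"
  define W where "W = 2 powr (r * (2 - p))"
  define X where "X = x i powr (p - 3)"
  define Y where "Y = (2 * T - x i) powr (p - 3)"
  define Z where "Z = (T - bdry_dist T (x i) + h N) powr (p - 2)"
  define w where "w y z = \<bar>y - z\<bar> powr p" for y z :: real
  let ?\<Sigma> = "\<lambda>c y. \<Sum>j = 1..2 * N - 1. c j * dd3 (w y) (x (j - 1)) (x j) (x (j + 1))"
  have i': "1 \<le> 2 * N - i" "2 * N - i \<le> 2 * N - 1" and refl: "x (2 * N - i) = 2 * T - x i"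
    using i mesh_reflect[of i] by auto
  have x_bounds: "0 \<le> x k" "x k \<le> 2 * T" if "k \<in> {i - 1, i, i + 1}" for k
    using that i mesh_le[of 0 k] mesh_le[of k "2 * N"] mesh_0 mesh_2N by auto
  have reflL: "L (\<lambda>y. f (2 * T - y)) = dd3 f (x (2 * N - i - 1)) (x (2 * N - i)) (x (2 * N - i + 1))" for f
    unfolding L_def by (rule dd3_mesh_reflect[OF i])
  note width = width_mesh_reflect[OF i]

  have g1: "L g \<le> - (Q * X) * D"
    using dd3_mesh_boundary_layer_le[OF p i] unfolding L_def g_def Q_def X_def D_def by simp
  \<comment> \<open>The layer at \<open>2 * T\<close> is the left one seen from node
    \<open>2 * N - i\<close>, which lies at \<open>2 * T - x i\<close> and has a stencil of the same
    width.\<close>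
  have g2: "L (\<lambda>y. g (2 * T - y)) \<le> - (Q * Y) * D"
    using dd3_mesh_boundary_layer_le[OF p i'] unfolding reflL width refl
    unfolding L_def g_def Q_def Y_def D_def by simp
  have P1: "L (\<lambda>y. y powr p) \<le> p * (p - 1) * (W * (2 * T) * X) * D"
    using dd3_mesh_powr_le[OF p i] unfolding L_def W_def X_def D_def by simp
  have P2: "L (\<lambda>y. (2 * T - y) powr p) \<le> p * (p - 1) * (W * (2 * T) * Y) * D"
    using dd3_mesh_powr_le[OF p i'] unfolding reflL[of "\<lambda>y. y powr p"] width refl
    unfolding W_def Y_def D_def by simp
  have A: "p * (p - 1) * Z * D \<le> L (\<lambda>y. \<bar>y - T\<bar> powr p)"
    using dd3_mesh_powr_abs_ge[OF p i] unfolding L_def Z_def D_def by simp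

  have sum1: "L (?\<Sigma> (\<lambda>_. 1)) = L g + L (\<lambda>y. g (2 * T - y))"
  proof -
    \<comment> \<open>The absolute values resolve for \<open>y\<close> between 0 and
      \<open>2 * T\<close>, which suffices because \<open>L\<close> sees three mesh nodes
      only.\<close>
    have "?\<Sigma> (\<lambda>_. 1) y = g y + g (2 * T - y)" if "0 \<le> y" "y \<le> 2 * T" for y
    proof -
      have "\<bar>2 * T - y - x 1\<bar> = \<bar>y - (2 * T - x 1)\<bar>"
        by arith
      then show ?thesis
        using that by (simp only: mult_1 sum_dd3_mesh) (simp add: g_def w_def diff_divide_distrib)
    qed
    then have "L (?\<Sigma> (\<lambda>_. 1)) = L (\<lambda>y. g y + g (2 * T - y))"
      unfolding L_def by (intro dd3_cong) (use x_bounds in auto)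
    then show ?thesis
      by (simp add: L_def dd3_add)
  qed
  have sum2: "L (?\<Sigma> (\<lambda>j. bdry_dist T (x j))) = L (\<lambda>y. y powr p) + L (\<lambda>y. (2 * T - y) powr p) + (- 2) * L (\<lambda>y. \<bar>y - T\<bar> powr p)"
  proof -
    have "?\<Sigma> (\<lambda>j. bdry_dist T (x j)) y = y powr p + (2 * T - y) powr p + (- 2) * \<bar>y - T\<bar> powr p"
      if "0 \<le> y" "y \<le> 2 * T" for y
      using that by (simp only: sum_bdry_dist_dd3_mesh) (simp add: w_def)
    then have "L (?\<Sigma> (\<lambda>j. bdry_dist T (x j))) =
        L (\<lambda>y. y powr p + (2 * T - y) powr p + (- 2) * \<bar>y - T\<bar> powr p)"
      unfolding L_def by (intro dd3_cong) (use x_bounds in auto)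
    then show ?thesis
      unfolding L_def dd3_add dd3_cmult .
  qed

  have "(\<Sum>j = 1..2 * N - 1. stiffness_entry \<alpha> T r N i j * (lam + mu * bdry_dist T (x j))) =
    - (K / D * (lam * (\<Sum>j = 1..2 * N - 1. 1 * L (\<lambda>y. dd3 (w y) (x (j - 1)) (x j) (x (j + 1))))
      + mu * (\<Sum>j = 1..2 * N - 1. bdry_dist T (x j) * L (\<lambda>y. dd3 (w y) (x (j - 1)) (x j) (x (j + 1))))))"
    unfolding stiffness_entry_eq_dd3 K_def[symmetric] p_def[symmetric] w_def[symmetric] L_def[symmetric]
    by (simp add: D_def sum_distrib_left sum_negf[symmetric] sum.distrib[symmetric] add_divide_distrib algebra_simps)
  \<comment> \<open>By linearity \<open>L\<close> acts after the summation over \<open>j\<close>,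
    where the closed forms are available.\<close>
  also have "\<dots> = - (K / D * (lam * L (?\<Sigma> (\<lambda>_. 1)) + mu * L (?\<Sigma> (\<lambda>j. bdry_dist T (x j)))))"
    unfolding L_def by (simp only: dd3_sum finite_atLeastAtMost dd3_cmult)
  also have "\<dots> \<ge> - (K / D * (lam * (- (Q * X) * D + - (Q * Y) * D) +
      mu * (p * (p - 1) * (W * (2 * T) * X) * D + p * (p - 1) * (W * (2 * T) * Y) * D
        + (- 2) * (p * (p - 1) * Z * D))))"
  proof -
    have B2: "L (\<lambda>y. y powr p) + L (\<lambda>y. (2 * T - y) powr p) + (- 2) * L (\<lambda>y. \<bar>y - T\<bar> powr p)
        \<le> p * (p - 1) * (W * (2 * T) * X) * D + p * (p - 1) * (W * (2 * T) * Y) * D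
          + (- 2) * (p * (p - 1) * Z * D)"
      using P1 P2 A by linarith
    have "0 \<le> lam" "0 \<le> mu"
      using T \<alpha> by (auto simp: lam mu)
    then show ?thesis
      unfolding sum1 sum2 using K D
      by (intro le_imp_neg_le mult_left_mono[OF add_mono[OF mult_left_mono[OF add_mono[OF g1 g2]] mult_left_mono[OF B2]]])
        auto
  qed
  also have "- (K / D * (lam * (- (Q * X) * D + - (Q * Y) * D) +
      mu * (p * (p - 1) * (W * (2 * T) * X) * D + p * (p - 1) * (W * (2 * T) * Y) * D
        + (- 2) * (p * (p - 1) * Z * D)))) = K * Q * (X + Y + Z)"
  proof -
    \<comment> \<open>The choice of the weights: as \<open>mu * (p * (p - 1)) = Q / 2\<close>, the
      unwanted term is \<open>Q * W * T * (X + Y)\<close>. The part \<open>W * T\<close> of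
      \<open>lam\<close> cancels it, the part 1 leaves \<open>Q * (X + Y)\<close>, and the centre
      term gives \<open>Q * Z\<close>.\<close>
    have lam': "lam = 1 + W * T"
      by (simp add: lam W_def p_def)
    have "2 powr (- r * \<alpha> - 1) = 2 powr (- r * \<alpha>) / (2 :: real)"
      by (simp add: powr_diff)
    moreover have "r * (p - 3) = - r * \<alpha>"
      by (simp add: p_def)
    ultimately have mu': "mu * (p * (p - 1)) = Q / 2"
      unfolding mu Q_def by (simp only:) (simp add: p_def algebra_simps)
    have eq: "- (K / D * (lam * (- (Q * X) * D + - (Q * Y) * D) +
      mu * (p * (p - 1) * (W * (2 * T) * X) * D + p * (p - 1) * (W * (2 * T) * Y) * D
        + (- 2) * (p * (p - 1) * Z * D)))) =
      K * (lam * Q * (X + Y) - mu * (p * (p - 1)) * (W * (2 * T) * (X + Y) - 2 * Z))"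
      using D by (simp add: field_simps)
    show ?thesis
      unfolding eq unfolding mu' lam' by (simp add: field_simps)
  qed
  also have "K * Q = kappa \<alpha> * (\<alpha> - 1) / Gamma (2 - \<alpha>) * 2 powr (- r * \<alpha>)"
  proof -
    have cancel: "k / (u * v * G) * (u * v * c * E) = k * c / G * E" if "u \<noteq> 0" "v \<noteq> 0" for k u v G c E :: real
      using that by simp
    have eqs: "Gamma (4 - \<alpha>) = p * (p - 1) * Gamma (2 - \<alpha>)" "r * (p - 3) = - r * \<alpha>" "2 - p = \<alpha> - 1"
      using Gamma_4_minus[OF \<alpha>(2)] by (simp_all add: p_def)
    show ?thesis
      unfolding K_def Q_def eqs by (rule cancel) (use p in auto)
  qed
  finally show ?thesis
    by (simp add: X_def Y_def Z_def p_def)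
qed

end

section \<open>Signs and diagonal dominance of the product matrix\<close>

theorem lemma4p3:
  fixes \<alpha> T r lam mu C\<^sub>A :: real and N :: nat and A G B :: "real mat"
  assumes "1 < \<alpha>" and "\<alpha> < 2" and "0 < T" and "1 \<le> r" and "1 \<le> N"
    and "A = stiffness_mat \<alpha> T r N"
    and "G = bdry_dist_mat T r N"
    and "lam = 1 + 2 powr (r * (\<alpha> - 1)) * T"
    and "mu = (\<alpha> - 1) * 2 powr (- r * \<alpha> - 1)"
    and "B = A * (lam \<cdot>\<^sub>m 1\<^sub>m (2 * N - 1) + mu \<cdot>\<^sub>m G)"
    and "C\<^sub>A = kappa \<alpha> * (\<alpha> - 1) / Gamma (2 - \<alpha>) * 2 powr (- r * \<alpha>)"
  shows "B \<in> carrier_mat (2 * N - 1) (2 * N - 1)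
    \<and> strictly_diag_dominant B
    \<and> (\<forall>i < 2 * N - 1. 0 < B $$ (i, i))
    \<and> (\<forall>i < 2 * N - 1. \<forall>j < 2 * N - 1. i \<noteq> j \<longrightarrow> B $$ (i, j) < 0)
    \<and> (\<forall>i \<in> {1..2 * N - 1}.
         (\<Sum>j = 1..2 * N - 1. B $$ (i - 1, j - 1))
         \<ge> C\<^sub>A * ((mesh T r N i powr (- \<alpha>) + (2 * T - mesh T r N i) powr (- \<alpha>))
                  + (T - bdry_dist T (mesh T r N i) + mesh_size T r N N) powr (1 - \<alpha>)))"
proof -
  let ?n = "2 * N - 1"
  let ?x = "mesh T r N"
  interpret graded_mesh_stiffness T r N \<alpha>
    using assms(1-5) by unfold_locales
  define b where "b i j = stiffness_entry \<alpha> T r N i j * (lam + mu * bdry_dist T (?x j))" for i j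
  have D: "lam \<cdot>\<^sub>m 1\<^sub>m ?n + mu \<cdot>\<^sub>m G = mat_diag ?n (\<lambda>j. lam + mu * bdry_dist T (?x (j + 1)))"
    unfolding assms(7) bdry_dist_mat_def mat_diag_def by (rule eq_matI) auto
  have A: "A \<in> carrier_mat ?n ?n"
    by (simp add: assms(6) stiffness_mat_def)
  \<comment> \<open>Multiplying by a diagonal matrix from the right scales the columns. Indices of
    \<open>b\<close> start at 1, those of \<open>B\<close> at 0.\<close>
  have B: "B = Matrix.mat ?n ?n (\<lambda>(i, j). b (i + 1) (j + 1))"
    unfolding assms(10) D mat_diag_mult_right[OF A]
    by (rule eq_matI) (auto simp: assms(6) stiffness_mat_def b_def)
  have entry: "B $$ (i, j) = b (i + 1) (j + 1)" if "i < ?n" "j < ?n" for i j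
    using that by (simp add: B)
  have off: "B $$ (i, j) < 0" if "i < ?n" "j < ?n" "i \<noteq> j" for i j
  proof -
    have "0 \<le> bdry_dist T (?x (j + 1))"
      using mesh_le[of 0 "j + 1"] mesh_le[of "j + 1" "2 * N"] mesh_0 mesh_2N that
      by (simp add: bdry_dist_def)
    then have "0 < lam + mu * bdry_dist T (?x (j + 1))"
      using assms(1,3) by (auto simp: assms(8,9) intro!: add_pos_nonneg)
    then show ?thesis
      using stiffness_entry_neg[of "i + 1" "j + 1"] that
      by (auto simp: entry b_def mult_less_0_iff)
  qed
  have sum_shift: "(\<Sum>j = 1..?n. B $$ (i, j - 1)) = (\<Sum>j<?n. B $$ (i, j))" for i
    by (rule sum.reindex_bij_witness[of _ Suc "\<lambda>j. j - 1"]) auto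
  have row: "C\<^sub>A * ((?x i powr (- \<alpha>) + (2 * T - ?x i) powr (- \<alpha>))
      + (T - bdry_dist T (?x i) + mesh_size T r N N) powr (1 - \<alpha>)) \<le> (\<Sum>j = 1..?n. B $$ (i - 1, j - 1))"
    if i: "1 \<le> i" "i \<le> ?n" for i
  proof -
    have "(\<Sum>j = 1..?n. B $$ (i - 1, j - 1)) = (\<Sum>j = 1..?n. b i j)"
      using i by (intro sum.cong) (auto simp: entry)
    then show ?thesis
      using row_sum_ge[OF i assms(8,9)] by (simp add: b_def assms(11))
  qed
  have row_pos: "0 < (\<Sum>j<?n. B $$ (i, j))" if "i < ?n" for i
  proof -
    have "0 < C\<^sub>A"
      using assms(1,2) kappa_pos by (simp add: assms(11) Gamma_real_pos)
    \<comment> \<open>This makes the first power strictly positive; the other two are nonnegative,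
      as every \<open>powr\<close> is.\<close>
    moreover have "0 < ?x (i + 1)"
      using mesh_less[of 0 "i + 1"] mesh_0 that by simp
    ultimately have "0 < C\<^sub>A * ((?x (i + 1) powr (- \<alpha>) + (2 * T - ?x (i + 1)) powr (- \<alpha>))
      + (T - bdry_dist T (?x (i + 1)) + mesh_size T r N N) powr (1 - \<alpha>))"
      by (intro mult_pos_pos add_pos_nonneg) auto
    also have "\<dots> \<le> (\<Sum>j = 1..?n. B $$ (i + 1 - 1, j - 1))"
      using that by (intro row) auto
    also have "\<dots> = (\<Sum>j<?n. B $$ (i, j))"
      using sum_shift by simp
    finally show ?thesis .
  qed
  have dom: "(\<Sum>j \<in> {..<?n} - {i}. \<bar>B $$ (i, j)\<bar>) < B $$ (i, i)" if i: "i < ?n" for i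
  proof -
    \<comment> \<open>All off-diagonal entries are negative, so dominance with a positive diagonal
      entry is exactly positivity of the row sum.\<close>
    have "(\<Sum>j \<in> {..<?n} - {i}. \<bar>B $$ (i, j)\<bar>) = - (\<Sum>j \<in> {..<?n} - {i}. B $$ (i, j))"
      unfolding sum_negf[symmetric] using off[OF i] by (intro sum.cong) (auto simp: abs_of_neg)
    moreover have "(\<Sum>j<?n. B $$ (i, j)) = B $$ (i, i) + (\<Sum>j \<in> {..<?n} - {i}. B $$ (i, j))"
      using i by (intro sum.remove) auto
    ultimately show ?thesis
      using row_pos[OF i] by simp
  qed
  have diag: "0 < B $$ (i, i)" if "i < ?n" for i
    using dom[OF that] by (smt (verit) sum_nonneg abs_ge_zero)
  have "(\<Sum>j \<in> {..<?n} - {i}. \<bar>B $$ (i, j)\<bar>) < \<bar>B $$ (i, i)\<bar>" if "i < ?n" for i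
    using dom[OF that] diag[OF that] by simp
  moreover have "dim_row B = ?n" "dim_col B = ?n"
    by (simp_all add: B)
  ultimately have "strictly_diag_dominant B"
    by (simp only: strictly_diag_dominant_def square_mat.simps) blast
  then show ?thesis
    using diag off row by (auto simp: B)
qed

end
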